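(* Let $\mathbb{S}$ be a metric space, let $\{P_n\}_{n=1,2,\ldots}$ be a sequence of probability measures from $\mathbb{P}(\mathbb{S})$ and let $P\in\mathbb{P}(\mathbb{S})$. If the topology on $\mathbb{S}$ has a countable base $\tau_b$, then $P_n$ converges weakly to $P$ if and only if $\liminf_{n\to\infty}P_n(\mathcal{O}^* )\ge P(\mathcal{O}^* )$ for each finite union $\mathcal{O}^*=\bigcup_{i=1}^k\mathcal{O}_i$ with $\mathcal{O}_i\in\tau_b$, $k=1,2,\ldots$.
   Context: $\mathbb{P}(\mathbb{S})$ is the set of probability measures on $(\mathbb{S},\mathcal{B}(\mathbb{S}))$, where $\mathcal{B}(\mathbb{S})$ is the Borel $\sigma$-field of $\mathbb{S}$. $P_n$ converges weakly to $P$ if $\int_{\mathbb{S}}f\,dP_n\to\int_{\mathbb{S}}f\,dP$ for every bounded continuous $f:\mathbb{S}\to\mathbb{R}$. *)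

theory Defs
  imports "HOL-Probability.Probability"
begin

text \<open>
  The library's \<^const>\<open>weak_conv_m\<close> is defined through distribution functions and only
  covers measures on the reals; the following is the general notion, by bounded continuous
  real-valued test functions. It is meant for probability measures on the Borel sets.
\<close>

definition weakly_converges :: "(nat \<Rightarrow> 'a::topological_space measure) \<Rightarrow> 'a measure \<Rightarrow> bool"
  where "weakly_converges Pn P \<longleftrightarrow>
    (\<forall>f :: 'a \<Rightarrow> real. continuous_on UNIV f \<and> bounded (range f) \<longrightarrow>
      (\<lambda>n. \<integral>x. f x \<partial>Pn n) \<longlonglongrightarrow> (\<integral>x. f x \<partial>P))"

end

theory Submission imports Defs begin

text \<open>
  The pivot is the condition that \<open>liminf Pn(O) \<ge> P(O)\<close> holds for every open \<open>O\<close>.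

  It follows from weak convergence because, in a metric space, the indicator of an open set is
  the increasing limit of continuous functions with values in \<open>[0, 1]\<close>
  (\<open>weakly_converges_imp_liminf_open\<close>). Conversely, the expectation of a nonnegative function
  \<open>g\<close> is the integral over \<open>t \<ge> 0\<close> of the probabilities of \<open>{g > t}\<close>, and these sets are open
  when \<open>g\<close> is continuous; Fatou's lemma in the variable \<open>t\<close> then turns the condition on open sets
  into a lower bound for \<open>liminf\<close> of the expectations. Applied to \<open>c + f\<close> and to \<open>c - f\<close>, for a
  bound \<open>c\<close> of \<open>\<bar>f\<bar>\<close>, it bounds the expectations of \<open>f\<close> asymptotically from both sides
  (\<open>liminf_open_imp_weakly_converges\<close>).

  Finally, a countable base reduces open sets to finite unions of basic ones: an open set
  is the increasing union of such finite unions, so by continuity from below \<open>P(O)\<close> is the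
  supremum of their measures, while \<open>Pn(O)\<close> dominates each of them
  (\<open>liminf_open_if_liminf_finite_unions\<close>).
\<close>

section \<open>From weak convergence to open sets\<close>

text \<open>
  Truncated multiples of the distance to the complement approximate the indicator. The whole
  space is excluded since the distance to the empty set has the default value \<open>0\<close>.
\<close>

lemma infdist_truncation_tendsto_indicator:
  fixes A :: "'a::metric_space set"
  assumes "open A" and "A \<noteq> UNIV"
  shows "(\<lambda>m. min 1 (real m * infdist x (- A))) \<longlonglongrightarrow> indicator A x"
proof (cases "x \<in> A")
  case True
  have "infdist x (- A) > 0"
    using assms True infdist_pos_not_in_closed[of "- A" x] by auto
  then obtain N where N: "1 < real N * infdist x (- A)"
    using reals_Archimedean3 by blast
  have "\<forall>\<^sub>F m in sequentially. min 1 (real m * infdist x (- A)) = 1"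
    using eventually_ge_at_top[of N]
  proof eventually_elim
    case (elim m)
    have "real N * infdist x (- A) \<le> real m * infdist x (- A)"
      using elim by (intro mult_right_mono infdist_nonneg) auto
    with N show ?case by simp
  qed
  then show ?thesis using True by (simp add: tendsto_eventually)
next
  case False
  then show ?thesis by simp
qed

text \<open>
  The approximations \<open>f m\<close> stay below the indicator of \<open>A\<close>. Hence, for each fixed \<open>m\<close>, weak
  convergence gives \<open>\<integral>f m dP = lim \<integral>f m dPn \<le> liminf Pn(A)\<close>, and the left-hand
  side tends to \<open>P(A)\<close> as \<open>m\<close> grows.
\<close>

lemma weakly_converges_imp_liminf_open:
  fixes Pn :: "nat \<Rightarrow> 'a::metric_space measure"
  assumes Pn: "\<And>n. prob_space (Pn n)" "\<And>n. sets (Pn n) = sets borel"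
    and P: "prob_space P" "sets P = sets borel"
    and weak: "weakly_converges Pn P"
    and "open A"
  shows "emeasure P A \<le> liminf (\<lambda>n. emeasure (Pn n) A)"
proof (cases "A = UNIV")
  case True
  have "emeasure P A = 1"
    using prob_space.emeasure_space_1[OF P(1)] sets_eq_imp_space_eq[OF P(2)] True by simp
  moreover have "emeasure (Pn n) A = 1" for n
    using prob_space.emeasure_space_1[OF Pn(1)] sets_eq_imp_space_eq[OF Pn(2)] True
    by (metis space_borel)
  ultimately show ?thesis by (simp add: Liminf_const)
next
  case False
  define f where "f m x = min 1 (real m * infdist x (- A))" for m x
  have cont: "continuous_on UNIV (f m)" for m
    unfolding f_def by (intro continuous_intros)
  have f_nonneg: "0 \<le> f m x" for m x
    by (simp add: f_def infdist_nonneg)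
  have f_le: "f m x \<le> indicator A x" for m x
    by (cases "x \<in> A") (auto simp: f_def)
  have f_le_1: "f m x \<le> 1" for m x
    by (simp add: f_def)
  have bdd: "bounded (range (f m))" for m
    by (rule boundedI[of _ 1]) (use f_nonneg f_le_1 in auto)
  have meas: "f m \<in> borel_measurable Q" if "sets Q = sets borel" for m and Q :: "'a measure"
    using borel_measurable_continuous_onI[OF cont] measurable_cong_sets[OF that refl] by blast
  have bound: "ennreal (\<integral>x. f m x \<partial>Q) \<le> emeasure Q A"
    if Q: "prob_space Q" "sets Q = sets borel" for m and Q :: "'a measure"
  proof -
    interpret Q: prob_space Q by fact
    have A: "A \<in> sets Q" using \<open>open A\<close> Q by simp
    have "integrable Q (f m)"
      by (rule Q.integrable_const_bound[of _ 1]) (use f_nonneg f_le_1 meas Q in auto)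
    then have "(\<integral>x. f m x \<partial>Q) \<le> (\<integral>x. indicator A x \<partial>Q)"
      using A f_le by (intro integral_mono) (auto simp: Q.emeasure_eq_measure)
    then show ?thesis using A sets.sets_into_space[OF A]
      by (simp add: Q.emeasure_eq_measure Int_absorb2 ennreal_leI)
  qed
  have below: "ennreal (\<integral>x. f m x \<partial>P) \<le> liminf (\<lambda>n. emeasure (Pn n) A)" for m
  proof -
    have "(\<lambda>n. \<integral>x. f m x \<partial>Pn n) \<longlonglongrightarrow> (\<integral>x. f m x \<partial>P)"
      using weak cont bdd unfolding weakly_converges_def by blast
    then have "(\<lambda>n. ennreal (\<integral>x. f m x \<partial>Pn n)) \<longlonglongrightarrow> ennreal (\<integral>x. f m x \<partial>P)"
      by (rule tendsto_ennrealI)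
    then have "ennreal (\<integral>x. f m x \<partial>P) = liminf (\<lambda>n. ennreal (\<integral>x. f m x \<partial>Pn n))"
      by (simp add: lim_imp_Liminf)
    also have "\<dots> \<le> liminf (\<lambda>n. emeasure (Pn n) A)"
      by (intro Liminf_mono always_eventually allI bound Pn)
    finally show ?thesis .
  qed
  interpret P: prob_space P by fact
  have A: "A \<in> sets P" using \<open>open A\<close> P by simp
  have "(\<lambda>m. \<integral>x. f m x \<partial>P) \<longlonglongrightarrow> (\<integral>x. indicator A x \<partial>P)"
  proof (rule integral_dominated_convergence[where w = "\<lambda>_. 1"])
    show "AE x in P. (\<lambda>m. f m x) \<longlonglongrightarrow> indicator A x"
      unfolding f_def
      using infdist_truncation_tendsto_indicator[OF \<open>open A\<close> False] by simp
  qed (use A meas P f_nonneg f_le_1 in auto)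
  then have "(\<lambda>m. ennreal (\<integral>x. f m x \<partial>P)) \<longlonglongrightarrow> emeasure P A"
    using A sets.sets_into_space[OF A]
    by (simp add: P.emeasure_eq_measure Int_absorb2)
  then show ?thesis
    by (rule LIMSEQ_le_const2) (use below in blast)
qed

section \<open>From open sets to weak convergence\<close>

text \<open>Tonelli's theorem for the region under the graph of \<open>g\<close>.\<close>

lemma (in sigma_finite_measure) nn_integral_eq_integral_tail:
  fixes g :: "'a \<Rightarrow> real"
  assumes [measurable]: "g \<in> borel_measurable M" and nonneg: "\<And>x. 0 \<le> g x"
  shows "(\<integral>\<^sup>+x. ennreal (g x) \<partial>M) =
    (\<integral>\<^sup>+t. indicator {0..} t * emeasure M {x \<in> space M. t < g x} \<partial>lborel)"
proof -
  interpret pair_sigma_finite M lborel ..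
  define h :: "'a \<times> real \<Rightarrow> ennreal"
    where "h = (\<lambda>(x, t). indicator {0..} t * indicator {z \<in> space (M \<Otimes>\<^sub>M lborel). snd z < g (fst z)} (x, t))"
  have [measurable]: "h \<in> borel_measurable (M \<Otimes>\<^sub>M lborel)"
    unfolding h_def by measurable
  have "(\<integral>\<^sup>+x. ennreal (g x) \<partial>M) = (\<integral>\<^sup>+x. (\<integral>\<^sup>+t. h (x, t) \<partial>lborel) \<partial>M)"
  proof (rule nn_integral_cong)
    fix x assume "x \<in> space M"
    then have "(\<integral>\<^sup>+t. h (x, t) \<partial>lborel) = (\<integral>\<^sup>+t. indicator {0..<g x} t \<partial>lborel)"
      by (intro nn_integral_cong) (auto simp: h_def indicator_def space_pair_measure)
    then show "ennreal (g x) = (\<integral>\<^sup>+t. h (x, t) \<partial>lborel)"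
      using nonneg by simp
  qed
  also have "\<dots> = (\<integral>\<^sup>+t. (\<integral>\<^sup>+x. h (x, t) \<partial>M) \<partial>lborel)"
    by (rule Fubini[symmetric]) measurable
  also have "\<dots> = (\<integral>\<^sup>+t. indicator {0..} t * emeasure M {x \<in> space M. t < g x} \<partial>lborel)"
  proof (rule nn_integral_cong)
    fix t :: real
    have "(\<integral>\<^sup>+x. h (x, t) \<partial>M) =
      (\<integral>\<^sup>+x. indicator {0..} t * indicator {x \<in> space M. t < g x} x \<partial>M)"
      by (intro nn_integral_cong) (auto simp: h_def indicator_def space_pair_measure)
    also have "\<dots> = indicator {0..} t * emeasure M {x \<in> space M. t < g x}"
      by (subst nn_integral_cmult) auto
    finally show "(\<integral>\<^sup>+x. h (x, t) \<partial>M) = \<dots>" .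
  qed
  finally show ?thesis .
qed

text \<open>
  Fatou's lemma with respect to the level \<open>t\<close>. The tails are measurable in \<open>t\<close> since they
  are monotone.
\<close>

lemma liminf_open_imp_nn_integral_le_liminf:
  fixes Pn :: "nat \<Rightarrow> 'a::topological_space measure"
  assumes Pn: "\<And>n. prob_space (Pn n)" "\<And>n. sets (Pn n) = sets borel"
    and P: "prob_space P" "sets P = sets borel"
    and liminf: "\<And>A. open A \<Longrightarrow> emeasure P A \<le> liminf (\<lambda>n. emeasure (Pn n) A)"
    and cont: "continuous_on UNIV g" and nonneg: "\<And>x. 0 \<le> (g x :: real)"
  shows "(\<integral>\<^sup>+x. ennreal (g x) \<partial>P) \<le> liminf (\<lambda>n. \<integral>\<^sup>+x. ennreal (g x) \<partial>Pn n)"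
proof -
  have tail: "(\<integral>\<^sup>+x. ennreal (g x) \<partial>Q) =
      (\<integral>\<^sup>+t. indicator {0..} t * emeasure Q {x. t < g x} \<partial>lborel)"
    and tail_measurable: "(\<lambda>t. indicator {0..} t * emeasure Q {x. t < g x}) \<in> borel_measurable lborel"
    if Q: "prob_space Q" "sets Q = sets borel" for Q :: "'a measure"
  proof -
    interpret Q: prob_space Q by fact
    have space: "space Q = UNIV" using sets_eq_imp_space_eq[OF Q(2)] by simp
    have g [measurable]: "g \<in> borel_measurable Q"
      using borel_measurable_continuous_onI[OF cont] measurable_cong_sets[OF Q(2) refl] by blast
    show "(\<integral>\<^sup>+x. ennreal (g x) \<partial>Q) =
        (\<integral>\<^sup>+t. indicator {0..} t * emeasure Q {x. t < g x} \<partial>lborel)"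
      using Q.nn_integral_eq_integral_tail[OF g nonneg] by (simp add: space)
    have "antimono (\<lambda>t. measure Q {x \<in> space Q. t < g x})"
      by (intro antimonoI Q.finite_measure_mono) auto
    then have "mono (\<lambda>t. - measure Q {x \<in> space Q. t < g x})"
      by (simp add: monotone_def)
    from borel_measurable_uminus[OF borel_measurable_mono[OF this]]
    have [measurable]: "(\<lambda>t. measure Q {x. t < g x}) \<in> borel_measurable borel"
      by (simp add: space)
    show "(\<lambda>t. indicator {0..} t * emeasure Q {x. t < g x}) \<in> borel_measurable lborel"
      unfolding Q.emeasure_eq_measure by measurable
  qed
  have "(\<integral>\<^sup>+x. ennreal (g x) \<partial>P) = (\<integral>\<^sup>+t. indicator {0..} t * emeasure P {x. t < g x} \<partial>lborel)"
    by (rule tail[OF P])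
  also have "\<dots> \<le> (\<integral>\<^sup>+t. liminf (\<lambda>n. indicator {0..} t * emeasure (Pn n) {x. t < g x}) \<partial>lborel)"
  proof (rule nn_integral_mono)
    fix t :: real
    have "open {x. t < g x}"
      using cont by (intro open_Collect_less continuous_intros)
    from liminf[OF this]
    show "indicator {0..} t * emeasure P {x. t < g x} \<le>
        liminf (\<lambda>n. indicator {0..} t * emeasure (Pn n) {x. t < g x})"
      by (cases "t \<ge> 0") auto
  qed
  also have "\<dots> \<le> liminf (\<lambda>n. \<integral>\<^sup>+t. indicator {0..} t * emeasure (Pn n) {x. t < g x} \<partial>lborel)"
    by (intro nn_integral_liminf tail_measurable Pn)
  also have "\<dots> = liminf (\<lambda>n. \<integral>\<^sup>+x. ennreal (g x) \<partial>Pn n)"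
    by (simp only: tail[OF Pn])
  finally show ?thesis .
qed

lemma liminf_open_imp_weakly_converges:
  fixes Pn :: "nat \<Rightarrow> 'a::topological_space measure"
  assumes Pn: "\<And>n. prob_space (Pn n)" "\<And>n. sets (Pn n) = sets borel"
    and P: "prob_space P" "sets P = sets borel"
    and liminf: "\<And>A. open A \<Longrightarrow> emeasure P A \<le> liminf (\<lambda>n. emeasure (Pn n) A)"
  shows "weakly_converges Pn P"
  unfolding weakly_converges_def
proof (intro allI impI, elim conjE)
  fix f :: "'a \<Rightarrow> real"
  assume cont: "continuous_on UNIV f" and "bounded (range f)"
  then obtain c where c: "\<And>x. \<bar>f x\<bar> \<le> c"
    unfolding bounded_iff by auto
  have integrable: "integrable Q f" if Q: "prob_space Q" "sets Q = sets borel" for Q :: "'a measure"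
  proof -
    interpret Q: prob_space Q by fact
    have "f \<in> borel_measurable Q"
      using borel_measurable_continuous_onI[OF cont] measurable_cong_sets[OF Q(2) refl] by blast
    then show ?thesis
      using c by (intro Q.integrable_const_bound[of _ c]) auto
  qed
  \<comment> \<open>The sign \<open>s\<close> treats \<open>c + f\<close> and \<open>c - f\<close> together.\<close>
  have lower: "\<forall>\<^sub>F n in sequentially. y < s * (\<integral>x. f x \<partial>Pn n)"
    if s: "\<bar>s\<bar> = 1" and y: "y < s * (\<integral>x. f x \<partial>P)" for s y :: real
  proof -
    define g where "g x = c + s * f x" for x
    have nonneg: "0 \<le> g x" for x
      using c[of x] s by (cases "s \<ge> 0") (auto simp: g_def abs_if split: if_splits)
    have nn: "(\<integral>\<^sup>+x. ennreal (g x) \<partial>Q) = ennreal (c + s * (\<integral>x. f x \<partial>Q))"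
      and c_nonneg: "0 \<le> c + s * (\<integral>x. f x \<partial>Q)"
      if Q: "prob_space Q" "sets Q = sets borel" for Q :: "'a measure"
    proof -
      interpret Q: prob_space Q by fact
      have "integrable Q g" and eq: "(\<integral>x. g x \<partial>Q) = c + s * (\<integral>x. f x \<partial>Q)"
        unfolding g_def using integrable[OF Q] by (simp_all add: Q.prob_space)
      then show "(\<integral>\<^sup>+x. ennreal (g x) \<partial>Q) = ennreal (c + s * (\<integral>x. f x \<partial>Q))"
        using nonneg by (subst nn_integral_eq_integral) auto
      show "0 \<le> c + s * (\<integral>x. f x \<partial>Q)"
        unfolding eq[symmetric] using nonneg by (rule Bochner_Integration.integral_nonneg)
    qed
    have "continuous_on UNIV g"
      unfolding g_def using cont by (intro continuous_intros)
    then have "(\<integral>\<^sup>+x. ennreal (g x) \<partial>P) \<le> liminf (\<lambda>n. \<integral>\<^sup>+x. ennreal (g x) \<partial>Pn n)"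
      by (intro liminf_open_imp_nn_integral_le_liminf Pn P liminf nonneg)
    then have le: "ennreal (c + s * (\<integral>x. f x \<partial>P)) \<le> liminf (\<lambda>n. ennreal (c + s * (\<integral>x. f x \<partial>Pn n)))"
      by (simp only: nn[OF P] nn[OF Pn])
    \<comment> \<open>\<open>ennreal\<close> sends negative numbers to \<open>0\<close>, so \<open>le\<close> is informative only for \<open>c + y \<ge> 0\<close>.\<close>
    show ?thesis
    proof (cases "0 \<le> c + y")
      case True
      then have "ennreal (c + y) < ennreal (c + s * (\<integral>x. f x \<partial>P))"
        using y by (intro ennreal_lessI) auto
      with le have "\<forall>\<^sub>F n in sequentially. ennreal (c + y) < ennreal (c + s * (\<integral>x. f x \<partial>Pn n))"
        unfolding le_Liminf_iff by blast
      then show ?thesis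
        by eventually_elim (simp add: ennreal_less_iff True)
    next
      case False
      have "y < s * (\<integral>x. f x \<partial>Pn n)" for n
        using False c_nonneg[OF Pn, of n] by linarith
      then show ?thesis by simp
    qed
  qed
  show "(\<lambda>n. \<integral>x. f x \<partial>Pn n) \<longlonglongrightarrow> (\<integral>x. f x \<partial>P)"
  proof (rule order_tendstoI)
    fix a assume "a < (\<integral>x. f x \<partial>P)"
    then show "\<forall>\<^sub>F n in sequentially. a < (\<integral>x. f x \<partial>Pn n)"
      using lower[of 1 a] by simp
  next
    fix a assume "(\<integral>x. f x \<partial>P) < a"
    then show "\<forall>\<^sub>F n in sequentially. (\<integral>x. f x \<partial>Pn n) < a"
      using lower[of "-1" "- a"] by simp
  qed
qed

section \<open>Reduction to finite unions of basic sets\<close>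

lemma liminf_open_if_liminf_finite_unions:
  fixes Pn :: "nat \<Rightarrow> 'a::topological_space measure"
  assumes Pn: "\<And>n. sets (Pn n) = sets borel" and P: "sets P = sets borel"
    and B: "countable B" "topological_basis B"
    and liminf: "\<And>k U. 1 \<le> k \<Longrightarrow> \<forall>i\<in>{1..k::nat}. U i \<in> B \<Longrightarrow>
      emeasure P (\<Union>i\<in>{1..k}. U i) \<le> liminf (\<lambda>n. emeasure (Pn n) (\<Union>i\<in>{1..k}. U i))"
    and "open A"
  shows "emeasure P A \<le> liminf (\<lambda>n. emeasure (Pn n) A)"
proof (cases "A = {}")
  case False
  obtain C where C: "C \<subseteq> B" "\<Union>C = A"
    using B(2) \<open>open A\<close> unfolding topological_basis_def by blast
  have "C \<noteq> {}" using False C by auto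
  define U where "U = from_nat_into C"
  have range_U: "range U = C"
    unfolding U_def using \<open>C \<noteq> {}\<close> countable_subset[OF C(1) B(1)] by (rule range_from_nat_into)
  \<comment> \<open>The shift makes \<open>U 0\<close>, and not \<open>U 1\<close>, the first of the sets indexed from \<open>1\<close>.\<close>
  define V where "V k = (\<Union>i\<in>{1..Suc k}. U (i - 1))" for k
  have U_B: "U i \<in> B" for i using range_U C by auto
  have V_open: "open (V k)" for k
    unfolding V_def using topological_basis_open[OF B(2) U_B] by blast
  have "incseq V"
    unfolding V_def by (intro incseq_SucI UN_mono) auto
  have V_Union: "(\<Union>k. V k) = A"
  proof -
    have "(\<Union>k. V k) = (\<Union>i. U i)"
    proof (intro subset_antisym subsetI)
      fix x assume "x \<in> (\<Union>i. U i)"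
      then obtain i where "x \<in> U i" by blast
      then have "x \<in> V i" unfolding V_def by (intro UN_I[of "Suc i"]) auto
      then show "x \<in> (\<Union>k. V k)" by blast
    qed (auto simp: V_def)
    then show ?thesis using range_U C by simp
  qed
  have "emeasure P A = (SUP k. emeasure P (V k))"
    using SUP_emeasure_incseq[of V P] \<open>incseq V\<close> V_open P
    by (simp add: V_Union image_subset_iff)
  also have "\<dots> \<le> liminf (\<lambda>n. emeasure (Pn n) A)"
  proof (rule SUP_least)
    fix k
    have "emeasure P (V k) \<le> liminf (\<lambda>n. emeasure (Pn n) (V k))"
      unfolding V_def using U_B by (intro liminf) auto
    also have "\<dots> \<le> liminf (\<lambda>n. emeasure (Pn n) A)"
      using V_Union \<open>open A\<close> Pn
      by (intro Liminf_mono always_eventually allI emeasure_mono) auto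
    finally show "emeasure P (V k) \<le> \<dots>" .
  qed
  finally show ?thesis .
qed simp

theorem theorem3p3:
  fixes Pn :: "nat \<Rightarrow> 'a::metric_space measure"
    and P :: "'a measure"
    and \<tau>\<^sub>b :: "'a set set"
  assumes "\<And>n. prob_space (Pn n)" and "\<And>n. sets (Pn n) = sets borel"
    and "prob_space P" and "sets P = sets borel"
    and "countable \<tau>\<^sub>b" and "topological_basis \<tau>\<^sub>b"
  shows "weakly_converges Pn P \<longleftrightarrow>
    (\<forall>(k::nat)\<ge>1. \<forall>U :: nat \<Rightarrow> 'a set. (\<forall>i\<in>{1..k}. U i \<in> \<tau>\<^sub>b) \<longrightarrow>
      liminf (\<lambda>n. emeasure (Pn n) (\<Union>i\<in>{1..k}. U i)) \<ge> emeasure P (\<Union>i\<in>{1..k}. U i))"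
    (is "_ \<longleftrightarrow> ?finite_unions")
proof
  assume weak: "weakly_converges Pn P"
  show ?finite_unions
  proof (intro allI impI)
    fix k :: nat and U :: "nat \<Rightarrow> 'a set"
    assume "\<forall>i\<in>{1..k}. U i \<in> \<tau>\<^sub>b"
    then have "open (\<Union>i\<in>{1..k}. U i)"
      using topological_basis_open[OF assms(6)] by blast
    then show "emeasure P (\<Union>i\<in>{1..k}. U i) \<le> liminf (\<lambda>n. emeasure (Pn n) (\<Union>i\<in>{1..k}. U i))"
      by (rule weakly_converges_imp_liminf_open[OF assms(1-4) weak])
  qed
next
  assume finite_unions: ?finite_unions
  show "weakly_converges Pn P"
  proof (rule liminf_open_imp_weakly_converges[OF assms(1-4)])
    fix A :: "'a set" assume "open A"
    show "emeasure P A \<le> liminf (\<lambda>n. emeasure (Pn n) A)"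
    proof (rule liminf_open_if_liminf_finite_unions[OF assms(2,4,5,6) _ \<open>open A\<close>])
      fix k and U :: "nat \<Rightarrow> 'a set"
      assume "1 \<le> k" and "\<forall>i\<in>{1..k}. U i \<in> \<tau>\<^sub>b"
      then show "emeasure P (\<Union>i\<in>{1..k}. U i) \<le> liminf (\<lambda>n. emeasure (Pn n) (\<Union>i\<in>{1..k}. U i))"
        using finite_unions by simp
    qed
  qed
qed

end
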